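(* Let $\mathcal{S}$ be a triangulated category containing all set-indexed coproducts, and let $(\mathcal{P},\mathcal{I})$ be a (stable) projective class in $\mathcal{S}$ such that $\mathcal{I}$ is closed under countable coproducts. Then the Adams spectral sequence abutting to $\mathcal{S}(X,Y)$ is conditionally convergent for all $X$ and $Y$ if and only if the projective class generates.
   Context: Cofibre sequence means exact triangle. For a class $\mathcal{P}$ of objects, $\mathcal{P}\text{-null}$ is the class of maps $X\to Y$ such that every composite $P\to X\to Y$ with $P$ in $\mathcal{P}$ is zero; for a class $\mathcal{I}$ of maps, $\mathcal{I}\text{-proj}$ is the class of objects $P$ such that every composite $P\to X\to Y$ with $X\to Y$ in $\mathcal{I}$ is zero. A projective class is a pair $(\mathcal{P},\mathcal{I})$ with $\mathcal{P}\text{-null}=\mathcal{I}$, $\mathcal{I}\text{-proj}=\mathcal{P}$, such that each object $X$ lies in a cofibre sequence $P\to X\to Y$ with $P$ in $\mathcal{P}$ and $X\to Y$ in $\mathcal{I}$. It is stable if $\mathcal{P}$ and $\mathcal{I}$ are closed under suspension and desuspension. It generates if for each non-zero $X$ there is $P$ in $\mathcal{P}$ with $\mathcal{S}(P,X)\ne 0$. $\mathcal{I}$ is closed under countable coproducts if the coproduct of any countable family of maps in $\mathcal{I}$ is in $\mathcal{I}$. Write $\mathcal{S}(X,Y)_n=\mathcal{S}(\Sigma^nX,Y)$. An Adams resolution of $X$ is a sequence $X=X_0\to X_1\to X_2\to\cdots$ of maps in $\mathcal{I}$ together with exact triangles $P_n\to X_n\to X_{n+1}\to\Sigma P_n$ with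 each $P_n$ in $\mathcal{P}$. Applying $\mathcal{S}(-,Y)_*$ gives an exact couple with terms $\mathcal{S}(X_n,Y)_*$ and $\mathcal{S}(P_n,Y)_*$, whose spectral sequence (with $E_1^s=\mathcal{S}(P_s,Y)_*$) is the Adams spectral sequence abutting to $\mathcal{S}(X,Y)$; from $E_2$ on it is independent of the choice of resolution. It is conditionally convergent if $\varprojlim_k\mathcal{S}(X_k,Y)_*=0=\varprojlim^1_k\mathcal{S}(X_k,Y)_*$. *)

theory Defs
  imports "HOL-Algebra.Product_Groups"
begin

section \<open>Categories\<close>

text \<open>Arrows carry their source and target, and composition is written in
  applicative order: \<open>g \<cdot> f\<close> is \<open>f\<close> followed by \<open>g\<close>. It is only meaningful for
  composable arrows.\<close>

record ('o, 'm) cat =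
  Obj :: "'o set"
  Arr :: "'m set"
  Dom :: "'m \<Rightarrow> 'o"
  Cod :: "'m \<Rightarrow> 'o"
  Idn :: "'o \<Rightarrow> 'm"
  Comp :: "'m \<Rightarrow> 'm \<Rightarrow> 'm" (infixl "\<cdot>\<index>" 70)

definition mor :: "('o, 'm, 'z) cat_scheme \<Rightarrow> 'o \<Rightarrow> 'o \<Rightarrow> 'm set"
  where "mor C X Y = {f \<in> Arr C. Dom C f = X \<and> Cod C f = Y}"

locale category =
  fixes C :: "('o, 'm, 'z) cat_scheme" (structure)
  assumes dom_closed: "f \<in> Arr C \<Longrightarrow> Dom C f \<in> Obj C"
    and cod_closed: "f \<in> Arr C \<Longrightarrow> Cod C f \<in> Obj C"
    and idn_closed: "X \<in> Obj C \<Longrightarrow> Idn C X \<in> mor C X X"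
    and comp_closed: "f \<in> mor C X Y \<Longrightarrow> g \<in> mor C Y Z \<Longrightarrow> g \<cdot> f \<in> mor C X Z"
    and comp_assoc: "f \<in> mor C W X \<Longrightarrow> g \<in> mor C X Y \<Longrightarrow> h \<in> mor C Y Z \<Longrightarrow>
          h \<cdot> (g \<cdot> f) = (h \<cdot> g) \<cdot> f"
    and comp_idn_left: "f \<in> mor C X Y \<Longrightarrow> Idn C Y \<cdot> f = f"
    and comp_idn_right: "f \<in> mor C X Y \<Longrightarrow> f \<cdot> Idn C X = f"

definition inverse_arrows :: "('o, 'm, 'z) cat_scheme \<Rightarrow> 'o \<Rightarrow> 'o \<Rightarrow> 'm \<Rightarrow> 'm \<Rightarrow> bool"
  where "inverse_arrows C X Y f g \<longleftrightarrow> f \<in> mor C X Y \<and> g \<in> mor C Y X \<and>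
           g \<cdot>\<^bsub>C\<^esub> f = Idn C X \<and> f \<cdot>\<^bsub>C\<^esub> g = Idn C Y"

definition iso_arrow :: "('o, 'm, 'z) cat_scheme \<Rightarrow> 'o \<Rightarrow> 'o \<Rightarrow> 'm \<Rightarrow> bool"
  where "iso_arrow C X Y f \<longleftrightarrow> (\<exists>g. inverse_arrows C X Y f g)"

definition zero_object :: "('o, 'm, 'z) cat_scheme \<Rightarrow> 'o \<Rightarrow> bool"
  where "zero_object C Z \<longleftrightarrow> Z \<in> Obj C \<and>
           (\<forall>X\<in>Obj C. (\<exists>!f. f \<in> mor C X Z) \<and> (\<exists>!f. f \<in> mor C Z X))"

definition coproduct ::
    "('o, 'm, 'z) cat_scheme \<Rightarrow> 'j set \<Rightarrow> ('j \<Rightarrow> 'o) \<Rightarrow> 'o \<Rightarrow> ('j \<Rightarrow> 'm) \<Rightarrow> bool"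
  where "coproduct C J X A \<iota> \<longleftrightarrow> A \<in> Obj C \<and> (\<forall>j\<in>J. \<iota> j \<in> mor C (X j) A) \<and>
           (\<forall>B\<in>Obj C. \<forall>f. (\<forall>j\<in>J. f j \<in> mor C (X j) B) \<longrightarrow>
              (\<exists>!g. g \<in> mor C A B \<and> (\<forall>j\<in>J. g \<cdot>\<^bsub>C\<^esub> \<iota> j = f j)))"

definition has_coproduct :: "('o, 'm, 'z) cat_scheme \<Rightarrow> 'j set \<Rightarrow> ('j \<Rightarrow> 'o) \<Rightarrow> bool"
  where "has_coproduct C J X \<longleftrightarrow> (\<exists>A \<iota>. coproduct C J X A \<iota>)"

text \<open>HOL cannot quantify over all index types inside a formula, so the type whose subsets
  serve as index sets is a parameter, to be left as a free type variable. One must not bound the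
  hom-sets by \<open>'i\<close>: a category whose hom-sets inject into an index set for which it has
  coproducts is a preorder.\<close>

definition has_set_coproducts :: "'i itself \<Rightarrow> ('o, 'm, 'z) cat_scheme \<Rightarrow> bool"
  where "has_set_coproducts i C \<longleftrightarrow>
           (\<forall>(J :: 'i set) X. (\<forall>j\<in>J. X j \<in> Obj C) \<longrightarrow> has_coproduct C J X)"

definition endofunctor :: "('o, 'm, 'z) cat_scheme \<Rightarrow> ('o \<Rightarrow> 'o) \<Rightarrow> ('m \<Rightarrow> 'm) \<Rightarrow> bool"
  where "endofunctor C F G \<longleftrightarrow>
           (\<forall>X\<in>Obj C. F X \<in> Obj C \<and> G (Idn C X) = Idn C (F X)) \<and>
           (\<forall>X Y. \<forall>f\<in>mor C X Y. G f \<in> mor C (F X) (F Y)) \<and>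
           (\<forall>X Y Z. \<forall>f\<in>mor C X Y. \<forall>g\<in>mor C Y Z. G (g \<cdot>\<^bsub>C\<^esub> f) = G g \<cdot>\<^bsub>C\<^esub> G f)"


section \<open>Additive categories\<close>

record ('o, 'm) add_cat = "('o, 'm) cat" +
  Zer :: "'o \<Rightarrow> 'o \<Rightarrow> 'm"
  Add :: "'m \<Rightarrow> 'm \<Rightarrow> 'm" (infixl "\<oplus>\<^sub>m\<index>" 65)

text \<open>Hom-groups are groups in the (multiplicative) sense of HOL-Algebra.\<close>

definition Hom :: "('o, 'm, 'z) add_cat_scheme \<Rightarrow> 'o \<Rightarrow> 'o \<Rightarrow> 'm monoid"
  where "Hom C X Y = \<lparr>carrier = mor C X Y, monoid.mult = Add C, one = Zer C X Y\<rparr>"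

abbreviation Neg :: "('o, 'm, 'z) add_cat_scheme \<Rightarrow> 'o \<Rightarrow> 'o \<Rightarrow> 'm \<Rightarrow> 'm"
  where "Neg C X Y f \<equiv> inv\<^bsub>Hom C X Y\<^esub> f"

text \<open>The empty coproduct is a zero object, and binary coproducts are biproducts.\<close>

locale additive_category = category C
  for C :: "('o, 'm, 'z) add_cat_scheme" (structure) +
  assumes Hom_comm_group: "X \<in> Obj C \<Longrightarrow> Y \<in> Obj C \<Longrightarrow> comm_group (Hom C X Y)"
    and comp_add_left: "f \<in> mor C X Y \<Longrightarrow> g \<in> mor C Y Z \<Longrightarrow> g' \<in> mor C Y Z \<Longrightarrow>
          (g \<oplus>\<^sub>m g') \<cdot> f = (g \<cdot> f) \<oplus>\<^sub>m (g' \<cdot> f)"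
    and comp_add_right: "f \<in> mor C X Y \<Longrightarrow> f' \<in> mor C X Y \<Longrightarrow> g \<in> mor C Y Z \<Longrightarrow>
          g \<cdot> (f \<oplus>\<^sub>m f') = (g \<cdot> f) \<oplus>\<^sub>m (g \<cdot> f')"
    and finite_coproducts: "finite J \<Longrightarrow> (\<And>j. j \<in> J \<Longrightarrow> F j \<in> Obj C) \<Longrightarrow>
          has_coproduct C (J :: nat set) F"


section \<open>Triangulated categories\<close>

text \<open>The suspension is an auto-equivalence with a specified quasi-inverse \<open>Des\<close> and natural
  isomorphisms \<open>DesSus X: Des (Sus X) \<rightarrow> X\<close> and \<open>SusDes X: Sus (Des X) \<rightarrow> X\<close>; the case of a
  suspension automorphism is the one where these are identities. The suffix \<open>A\<close> marks the
  action on arrows.\<close>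

record ('o, 'm) tri_cat = "('o, 'm) add_cat" +
  Sus :: "'o \<Rightarrow> 'o"
  SusA :: "'m \<Rightarrow> 'm"
  Des :: "'o \<Rightarrow> 'o"
  DesA :: "'m \<Rightarrow> 'm"
  DesSus :: "'o \<Rightarrow> 'm"
  SusDes :: "'o \<Rightarrow> 'm"
  Tri :: "('m \<times> 'm \<times> 'm) set"

definition candidate_triangle ::
    "('o, 'm, 'z) tri_cat_scheme \<Rightarrow> 'o \<Rightarrow> 'o \<Rightarrow> 'o \<Rightarrow> 'm \<Rightarrow> 'm \<Rightarrow> 'm \<Rightarrow> bool"
  where "candidate_triangle S X Y Z f g h \<longleftrightarrow>
           f \<in> mor S X Y \<and> g \<in> mor S Y Z \<and> h \<in> mor S Z (Sus S X)"

definition exact_triangle ::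
    "('o, 'm, 'z) tri_cat_scheme \<Rightarrow> 'o \<Rightarrow> 'o \<Rightarrow> 'o \<Rightarrow> 'm \<Rightarrow> 'm \<Rightarrow> 'm \<Rightarrow> bool"
  where "exact_triangle S X Y Z f g h \<longleftrightarrow>
           candidate_triangle S X Y Z f g h \<and> (f, g, h) \<in> Tri S"

locale triangulated_category = additive_category S
  for S :: "('o, 'm, 'z) tri_cat_scheme" (structure) +
  assumes Sus_functor: "endofunctor S (Sus S) (SusA S)"
    and Sus_additive: "f \<in> mor S X Y \<Longrightarrow> g \<in> mor S X Y \<Longrightarrow>
          SusA S (f \<oplus>\<^sub>m g) = SusA S f \<oplus>\<^sub>m SusA S g"
    and Des_functor: "endofunctor S (Des S) (DesA S)"
    and DesSus_iso: "X \<in> Obj S \<Longrightarrow> iso_arrow S (Des S (Sus S X)) X (DesSus S X)"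
    and DesSus_natural: "f \<in> mor S X Y \<Longrightarrow>
          f \<cdot> DesSus S X = DesSus S Y \<cdot> DesA S (SusA S f)"
    and SusDes_iso: "X \<in> Obj S \<Longrightarrow> iso_arrow S (Sus S (Des S X)) X (SusDes S X)"
    and SusDes_natural: "f \<in> mor S X Y \<Longrightarrow>
          f \<cdot> SusDes S X = SusDes S Y \<cdot> SusA S (DesA S f)"
    and triangle_iso_closed:
      "exact_triangle S X Y Z f g h \<Longrightarrow> candidate_triangle S X' Y' Z' f' g' h' \<Longrightarrow>
       iso_arrow S X X' a \<Longrightarrow> iso_arrow S Y Y' b \<Longrightarrow> iso_arrow S Z Z' c \<Longrightarrow>
       b \<cdot> f = f' \<cdot> a \<Longrightarrow> c \<cdot> g = g' \<cdot> b \<Longrightarrow> SusA S a \<cdot> h = h' \<cdot> c \<Longrightarrow>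
       exact_triangle S X' Y' Z' f' g' h'"
    and triangle_idn: "X \<in> Obj S \<Longrightarrow> zero_object S Z \<Longrightarrow>
       exact_triangle S X X Z (Idn S X) (Zer S X Z) (Zer S Z (Sus S X))"
    and triangle_complete: "f \<in> mor S X Y \<Longrightarrow> \<exists>Z g h. exact_triangle S X Y Z f g h"
    and triangle_rotate: "candidate_triangle S X Y Z f g h \<Longrightarrow>
       exact_triangle S X Y Z f g h \<longleftrightarrow>
       exact_triangle S Y Z (Sus S X) g h (Neg S (Sus S X) (Sus S Y) (SusA S f))"
    and triangle_morphism:
      "exact_triangle S X Y Z f g h \<Longrightarrow> exact_triangle S X' Y' Z' f' g' h' \<Longrightarrow>
       a \<in> mor S X X' \<Longrightarrow> b \<in> mor S Y Y' \<Longrightarrow> b \<cdot> f = f' \<cdot> a \<Longrightarrow>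
       \<exists>c\<in>mor S Z Z'. c \<cdot> g = g' \<cdot> b \<and> SusA S a \<cdot> h = h' \<cdot> c"
    and octahedral:
      "exact_triangle S X Y U f f' f'' \<Longrightarrow> exact_triangle S Y Z W g g' g'' \<Longrightarrow>
       exact_triangle S X Z V (g \<cdot> f) h' h'' \<Longrightarrow>
       \<exists>u v. exact_triangle S U V W u v (SusA S f' \<cdot> g'') \<and>
         u \<cdot> f' = h' \<cdot> g \<and> h'' \<cdot> u = f'' \<and>
         v \<cdot> h' = g' \<and> g'' \<cdot> v = SusA S f \<cdot> h''"

definition sus_pow :: "('o, 'm, 'z) tri_cat_scheme \<Rightarrow> int \<Rightarrow> 'o \<Rightarrow> 'o"
  where "sus_pow S n = (if 0 \<le> n then Sus S ^^ nat n else Des S ^^ nat (- n))"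

definition sus_powA :: "('o, 'm, 'z) tri_cat_scheme \<Rightarrow> int \<Rightarrow> 'm \<Rightarrow> 'm"
  where "sus_powA S n = (if 0 \<le> n then SusA S ^^ nat n else DesA S ^^ nat (- n))"

text \<open>The comparison isomorphism from \<open>sus_pow n (Sus X)\<close> to \<open>sus_pow (n + 1) X\<close>. For
  \<open>n = - (k + 1)\<close> it is \<open>Des\<close>, iterated \<open>k\<close> times, applied to \<open>DesSus X\<close>.\<close>

definition sus_pow_shift :: "('o, 'm, 'z) tri_cat_scheme \<Rightarrow> int \<Rightarrow> 'o \<Rightarrow> 'm"
  where "sus_pow_shift S n X =
           (if 0 \<le> n then Idn S (sus_pow S (n + 1) X) else (DesA S ^^ nat (- n - 1)) (DesSus S X))"

definition graded_Hom :: "('o, 'm, 'z) tri_cat_scheme \<Rightarrow> 'o \<Rightarrow> 'o \<Rightarrow> int \<Rightarrow> 'm monoid"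
  where "graded_Hom S X Y n = Hom S (sus_pow S n X) Y"


section \<open>Projective classes\<close>

definition null_maps :: "('o, 'm, 'z) add_cat_scheme \<Rightarrow> 'o set \<Rightarrow> 'm set"
  where "null_maps S \<P> = {f \<in> Arr S. \<forall>P\<in>\<P>. \<forall>h\<in>mor S P (Dom S f).
           f \<cdot>\<^bsub>S\<^esub> h = Zer S P (Cod S f)}"

definition proj_objects :: "('o, 'm, 'z) add_cat_scheme \<Rightarrow> 'm set \<Rightarrow> 'o set"
  where "proj_objects S \<I> = {P \<in> Obj S. \<forall>f\<in>\<I>. \<forall>h\<in>mor S P (Dom S f).
           f \<cdot>\<^bsub>S\<^esub> h = Zer S P (Cod S f)}"

definition projective_class :: "('o, 'm, 'z) tri_cat_scheme \<Rightarrow> 'o set \<Rightarrow> 'm set \<Rightarrow> bool"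
  where "projective_class S \<P> \<I> \<longleftrightarrow> null_maps S \<P> = \<I> \<and> proj_objects S \<I> = \<P> \<and>
           (\<forall>X\<in>Obj S. \<exists>P\<in>\<P>. \<exists>Y. \<exists>i\<in>\<I>. \<exists>p d. exact_triangle S P X Y p i d)"

definition stable_class :: "('o, 'm, 'z) tri_cat_scheme \<Rightarrow> 'o set \<Rightarrow> 'm set \<Rightarrow> bool"
  where "stable_class S \<P> \<I> \<longleftrightarrow> (\<forall>P\<in>\<P>. Sus S P \<in> \<P> \<and> Des S P \<in> \<P>) \<and>
           (\<forall>f\<in>\<I>. SusA S f \<in> \<I> \<and> DesA S f \<in> \<I>)"

definition generates :: "('o, 'm, 'z) add_cat_scheme \<Rightarrow> 'o set \<Rightarrow> bool"
  where "generates S \<P> \<longleftrightarrow>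
           (\<forall>X\<in>Obj S. \<not> zero_object S X \<longrightarrow> (\<exists>P\<in>\<P>. \<not> trivial_group (Hom S P X)))"

text \<open>Every countable family is indexed by a set of natural numbers, up to reindexing.\<close>

definition closed_under_countable_coproducts ::
    "('o, 'm, 'z) cat_scheme \<Rightarrow> 'm set \<Rightarrow> bool"
  where "closed_under_countable_coproducts S \<I> \<longleftrightarrow>
           (\<forall>(J :: nat set) X Y f A \<iota> B \<kappa> g.
              (\<forall>j\<in>J. f j \<in> mor S (X j) (Y j) \<and> f j \<in> \<I>) \<longrightarrow>
              coproduct S J X A \<iota> \<longrightarrow> coproduct S J Y B \<kappa> \<longrightarrow>
              g \<in> mor S A B \<longrightarrow> (\<forall>j\<in>J. g \<cdot>\<^bsub>S\<^esub> \<iota> j = \<kappa> j \<cdot>\<^bsub>S\<^esub> f j) \<longrightarrow> g \<in> \<I>)"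


section \<open>Inverse limits of towers of abelian groups\<close>

text \<open>A tower \<open>G 0 \<leftarrow> G 1 \<leftarrow> G 2 \<leftarrow> \<dots>\<close> with \<open>q k: G (k + 1) \<rightarrow> G k\<close>. The groups \<open>lim\<close> and
  \<open>lim\<^sup>1\<close> are the kernel and cokernel of \<open>1 - shift\<close> on the product.\<close>

definition one_minus_shift ::
    "(nat \<Rightarrow> 'a monoid) \<Rightarrow> (nat \<Rightarrow> 'a \<Rightarrow> 'a) \<Rightarrow> (nat \<Rightarrow> 'a) \<Rightarrow> nat \<Rightarrow> 'a"
  where "one_minus_shift G q x = (\<lambda>k. x k \<otimes>\<^bsub>G k\<^esub> inv\<^bsub>G k\<^esub> (q k (x (Suc k))))"

definition lim0 :: "(nat \<Rightarrow> 'a monoid) \<Rightarrow> (nat \<Rightarrow> 'a \<Rightarrow> 'a) \<Rightarrow> (nat \<Rightarrow> 'a) monoid"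
  where "lim0 G q = (product_group UNIV G)\<lparr>carrier :=
           kernel (product_group UNIV G) (product_group UNIV G) (one_minus_shift G q)\<rparr>"

definition lim1 :: "(nat \<Rightarrow> 'a monoid) \<Rightarrow> (nat \<Rightarrow> 'a \<Rightarrow> 'a) \<Rightarrow> (nat \<Rightarrow> 'a) set monoid"
  where "lim1 G q = product_group UNIV G Mod
           (one_minus_shift G q ` carrier (product_group UNIV G))"


section \<open>The Adams spectral sequence\<close>

text \<open>An unrolled exact couple with filtration degree \<open>s\<close> and internal degree \<open>n\<close>:
  \<open>ci s n: D (s + 1) n \<rightarrow> D s n\<close>, \<open>cj s n: D s n \<rightarrow> E s n\<close>, \<open>ck s n: E s (n + 1) \<rightarrow> D (s + 1) n\<close>.\<close>

record ('d, 'e) couple =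
  cD :: "nat \<Rightarrow> int \<Rightarrow> 'd monoid"
  cE :: "nat \<Rightarrow> int \<Rightarrow> 'e monoid"
  ci :: "nat \<Rightarrow> int \<Rightarrow> 'd \<Rightarrow> 'd"
  cj :: "nat \<Rightarrow> int \<Rightarrow> 'd \<Rightarrow> 'e"
  ck :: "nat \<Rightarrow> int \<Rightarrow> 'e \<Rightarrow> 'd"

text \<open>Conditional convergence of a spectral sequence is a condition on the tower
  \<open>D 0 \<leftarrow> D 1 \<leftarrow> \<dots>\<close> of its exact couple, not on its pages.\<close>

definition conditionally_convergent :: "('d, 'e) couple \<Rightarrow> bool"
  where "conditionally_convergent K \<longleftrightarrow>
           (\<forall>n. trivial_group (lim0 (\<lambda>s. cD K s n) (\<lambda>s. ci K s n)) \<and>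
                trivial_group (lim1 (\<lambda>s. cD K s n) (\<lambda>s. ci K s n)))"

record ('o, 'm) resolution =
  rX :: "nat \<Rightarrow> 'o"
  rP :: "nat \<Rightarrow> 'o"
  rp :: "nat \<Rightarrow> 'm"
  ri :: "nat \<Rightarrow> 'm"
  rd :: "nat \<Rightarrow> 'm"

definition adams_resolution ::
    "('o, 'm, 'z) tri_cat_scheme \<Rightarrow> 'o set \<Rightarrow> 'm set \<Rightarrow> 'o \<Rightarrow> ('o, 'm) resolution \<Rightarrow> bool"
  where "adams_resolution S \<P> \<I> X R \<longleftrightarrow> rX R 0 = X \<and>
           (\<forall>s. rP R s \<in> \<P> \<and> ri R s \<in> \<I> \<and>
                exact_triangle S (rP R s) (rX R s) (rX R (Suc s)) (rp R s) (ri R s) (rd R s))"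

definition adams_couple ::
    "('o, 'm, 'z) tri_cat_scheme \<Rightarrow> ('o, 'm) resolution \<Rightarrow> 'o \<Rightarrow> ('m, 'm) couple"
  where "adams_couple S R Y = \<lparr>
           cD = (\<lambda>s n. graded_Hom S (rX R s) Y n),
           cE = (\<lambda>s n. graded_Hom S (rP R s) Y n),
           ci = (\<lambda>s n f. f \<cdot>\<^bsub>S\<^esub> sus_powA S n (ri R s)),
           cj = (\<lambda>s n f. f \<cdot>\<^bsub>S\<^esub> sus_powA S n (rp R s)),
           ck = (\<lambda>s n f. f \<cdot>\<^bsub>S\<^esub> sus_pow_shift S n (rP R s) \<cdot>\<^bsub>S\<^esub> sus_powA S n (rd R s))\<rparr>"

text \<open>The exact couple depends on the choice of resolution (its spectral sequence does not,
  from the second page on); the condition is required for every choice.\<close>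

definition adams_ss_conditionally_convergent ::
    "('o, 'm, 'z) tri_cat_scheme \<Rightarrow> 'o set \<Rightarrow> 'm set \<Rightarrow> 'o \<Rightarrow> 'o \<Rightarrow> bool"
  where "adams_ss_conditionally_convergent S \<P> \<I> X Y \<longleftrightarrow>
           (\<forall>R. adams_resolution S \<P> \<I> X R \<longrightarrow> conditionally_convergent (adams_couple S R Y))"

end

theory Submission
  imports Defs
begin

text \<open>Let \<open>f k: X k \<rightarrow> X (k + 1)\<close> be a tower of maps in \<open>\<I>\<close>, let \<open>A\<close> be the coproduct of the
  \<open>X k\<close>, and let \<open>s: A \<rightarrow> A\<close> be the shift, which is \<open>f k\<close> followed by the next inclusion on the
  summand \<open>X k\<close>. By the universal property, \<open>Hom(A, Y)\<close> is the product of the groups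
  \<open>Hom(X k, Y)\<close>, and precomposition with \<open>1 - s\<close> is the map of this product whose kernel and
  cokernel are \<open>lim\<close> and \<open>lim\<^sup>1\<close>. So both vanish for every \<open>Y\<close> as soon as \<open>1 - s\<close> is invertible,
  that is, as soon as its cone \<open>T\<close> (the telescope of the tower) is zero.

  If \<open>\<P>\<close> generates, it is. The shift factors through the coproduct of the maps \<open>f k\<close>, so it lies
  in \<open>\<I>\<close> because \<open>\<I>\<close> is closed under countable coproducts; hence it induces zero on \<open>Hom(P, A)\<close> for
  \<open>P\<close> in \<open>\<P>\<close>, and \<open>1 - s\<close> induces the identity. By stability the same holds after suspension, and
  the long exact sequence of \<open>Hom(P, -)\<close> squeezes \<open>Hom(P, T)\<close> to zero
  (\<open>cone_one_minus_null_zero\<close>, \<open>bij_one_minus_shift_null_tower\<close>). In internal degree \<open>n\<close> one applies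
  this to the \<open>n\<close>-fold suspension of the resolution, which by stability is again a tower in \<open>\<I>\<close>,
  rather than suspending \<open>A\<close>; this avoids comparing coproducts with their suspensions.

  Conversely, suppose that \<open>Hom(P, X) = 0\<close> for all \<open>P\<close> in \<open>\<P>\<close>. Then the identity of \<open>X\<close> lies in
  \<open>\<I>\<close>, and the constant tower \<open>X = X = \<dots>\<close> with zero projectives is an Adams resolution. The limit
  of \<open>Hom(-, X)\<close> along it is \<open>Hom(X, X)\<close>, so conditional convergence forces the identity of \<open>X\<close> to
  be zero (\<open>zero_of_conditionally_convergent\<close>).\<close>

section \<open>Additive categories\<close>

lemma (in category) mor_Obj:
  assumes "f \<in> mor C X Y"
  shows "X \<in> Obj C" "Y \<in> Obj C"
  using assms dom_closed cod_closed by (auto simp: mor_def)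

lemma Hom_simps [simp]:
  "carrier (Hom C X Y) = mor C X Y" "f \<otimes>\<^bsub>Hom C X Y\<^esub> g = f \<oplus>\<^sub>m\<^bsub>C\<^esub> g" "\<one>\<^bsub>Hom C X Y\<^esub> = Zer C X Y"
  by (simp_all add: Hom_def)

context additive_category
begin

lemma Hom_group: "X \<in> Obj C \<Longrightarrow> Y \<in> Obj C \<Longrightarrow> group (Hom C X Y)"
  using Hom_comm_group by (simp add: comm_group_def)

lemma Zer_mor: "X \<in> Obj C \<Longrightarrow> Y \<in> Obj C \<Longrightarrow> Zer C X Y \<in> mor C X Y"
  using group.is_monoid[OF Hom_group] monoid.one_closed[of "Hom C X Y"] by simp

lemma Neg_mor: "f \<in> mor C X Y \<Longrightarrow> Neg C X Y f \<in> mor C X Y"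
  using group.inv_closed[OF Hom_group] mor_Obj[of f X Y] by simp

lemma Add_mor: "f \<in> mor C X Y \<Longrightarrow> g \<in> mor C X Y \<Longrightarrow> f \<oplus>\<^sub>m g \<in> mor C X Y"
  using monoid.m_closed[OF group.is_monoid[OF Hom_group], of X Y f g] mor_Obj[of f X Y] by simp

lemma precomp_group_hom:
  assumes "f \<in> mor C X Y" "Z \<in> Obj C"
  shows "group_hom (Hom C Y Z) (Hom C X Z) (\<lambda>g. g \<cdot> f)"
  using assms mor_Obj[OF assms(1)]
  by (auto intro!: group_hom.intro group_hom_axioms.intro homI Hom_group
      simp: comp_closed comp_add_left)

lemma postcomp_group_hom:
  assumes "g \<in> mor C Y Z" "X \<in> Obj C"
  shows "group_hom (Hom C X Y) (Hom C X Z) (\<lambda>f. g \<cdot> f)"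
  using assms mor_Obj[OF assms(1)]
  by (auto intro!: group_hom.intro group_hom_axioms.intro homI Hom_group
      intro: comp_closed simp: comp_add_right)

lemma Zer_comp: "f \<in> mor C X Y \<Longrightarrow> Z \<in> Obj C \<Longrightarrow> Zer C Y Z \<cdot> f = Zer C X Z"
  using group_hom.hom_one[OF precomp_group_hom] by fastforce

lemma comp_Zer: "g \<in> mor C Y Z \<Longrightarrow> X \<in> Obj C \<Longrightarrow> g \<cdot> Zer C X Y = Zer C X Z"
  using group_hom.hom_one[OF postcomp_group_hom] by fastforce

lemma Neg_comp: "f \<in> mor C X Y \<Longrightarrow> g \<in> mor C Y Z \<Longrightarrow> Neg C Y Z g \<cdot> f = Neg C X Z (g \<cdot> f)"
  using group_hom.hom_inv[OF precomp_group_hom, of f X Y Z g] mor_Obj(2)[of g Y Z] by simp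

lemma comp_Neg: "f \<in> mor C X Y \<Longrightarrow> g \<in> mor C Y Z \<Longrightarrow> g \<cdot> Neg C X Y f = Neg C X Z (g \<cdot> f)"
  using group_hom.hom_inv[OF postcomp_group_hom, of g Y Z X f] mor_Obj(1)[of f X Y] by simp

lemma Neg_Zer: "X \<in> Obj C \<Longrightarrow> Y \<in> Obj C \<Longrightarrow> Neg C X Y (Zer C X Y) = Zer C X Y"
  using monoid.inv_one[OF group.is_monoid[OF Hom_group]] unfolding Hom_simps .

lemma Neg_Neg:
  assumes "f \<in> mor C X Y"
  shows "Neg C X Y (Neg C X Y f) = f"
  by (rule group.inv_inv[OF Hom_group[OF mor_Obj[OF assms]], unfolded Hom_simps, OF assms])

lemma Neg_inject:
  assumes "f \<in> mor C X Y" "g \<in> mor C X Y" "Neg C X Y f = Neg C X Y g"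
  shows "f = g"
  using Neg_Neg[OF assms(1)] Neg_Neg[OF assms(2)] unfolding assms(3) by (rule trans[OF sym])

lemma Add_Zer: "f \<in> mor C X Y \<Longrightarrow> f \<oplus>\<^sub>m Zer C X Y = f"
  using monoid.r_one[OF group.is_monoid[OF Hom_group[of X Y]], of f] mor_Obj[of f X Y] by simp

lemma Add_Neg: "f \<in> mor C X Y \<Longrightarrow> f \<oplus>\<^sub>m Neg C X Y f = Zer C X Y"
  using group.r_inv[OF Hom_group[of X Y], of f] mor_Obj[of f X Y] by simp

lemma zero_object_iff_Idn_eq_Zer:
  assumes "Z \<in> Obj C"
  shows "zero_object C Z \<longleftrightarrow> Idn C Z = Zer C Z Z"
proof
  assume "zero_object C Z"
  then show "Idn C Z = Zer C Z Z"
    using assms idn_closed[OF assms] Zer_mor[OF assms assms] unfolding zero_object_def by blast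
next
  assume eq: "Idn C Z = Zer C Z Z"
  have "f = Zer C X Z" if "f \<in> mor C X Z" for f X
    using comp_idn_left[OF that] Zer_comp[OF that assms] eq by simp
  moreover have "f = Zer C Z X" if "f \<in> mor C Z X" for f X
    using comp_idn_right[OF that] comp_Zer[OF that assms] eq by simp
  ultimately show "zero_object C Z"
    using assms Zer_mor unfolding zero_object_def by metis
qed

lemma zero_object_mor_from: "zero_object C Z \<Longrightarrow> f \<in> mor C Z X \<Longrightarrow> f = Zer C Z X"
  using mor_Obj Zer_mor unfolding zero_object_def by metis

lemma zero_object_exists: "\<exists>Z. zero_object C Z"
proof -
  have "has_coproduct C ({} :: nat set) (\<lambda>_. undefined)"
    by (rule finite_coproducts) auto
  then obtain Z and \<iota> :: "nat \<Rightarrow> 'm" where "coproduct C {} (\<lambda>_. undefined) Z \<iota>"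
    unfolding has_coproduct_def by blast
  then have Z: "Z \<in> Obj C" and uniq: "\<And>B. B \<in> Obj C \<Longrightarrow> \<exists>!g. g \<in> mor C Z B"
    by (auto simp: coproduct_def)
  have "Idn C Z = Zer C Z Z"
    using uniq[OF Z] idn_closed[OF Z] Zer_mor[OF Z Z] by blast
  then show ?thesis
    using zero_object_iff_Idn_eq_Zer[OF Z] by blast
qed

lemma iso_arrow_Idn: "X \<in> Obj C \<Longrightarrow> iso_arrow C X X (Idn C X)"
  unfolding iso_arrow_def inverse_arrows_def using idn_closed comp_idn_left by blast

lemma iso_arrow_zero_objects:
  assumes "zero_object C Z" "zero_object C Z'"
  shows "iso_arrow C Z Z' (Zer C Z Z')"
proof -
  have obj: "Z \<in> Obj C" "Z' \<in> Obj C"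
    using assms by (auto simp: zero_object_def)
  then have "inverse_arrows C Z Z' (Zer C Z Z') (Zer C Z' Z)"
    using assms Zer_mor zero_object_iff_Idn_eq_Zer Zer_comp[OF Zer_mor]
    unfolding inverse_arrows_def by metis
  then show ?thesis
    unfolding iso_arrow_def by blast
qed

lemma iso_arrow_cancel_right:
  assumes "iso_arrow C W X e" "f \<in> mor C X Y" "g \<in> mor C X Y" "f \<cdot> e = g \<cdot> e"
  shows "f = g"
proof -
  obtain e' where e: "e \<in> mor C W X" "e' \<in> mor C X W" "e \<cdot> e' = Idn C X"
    using assms(1) by (auto simp: iso_arrow_def inverse_arrows_def)
  have "(f \<cdot> e) \<cdot> e' = (g \<cdot> e) \<cdot> e'"
    using assms(4) by simp
  then show ?thesis
    using e assms(2,3) by (simp flip: comp_assoc add: comp_idn_right)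
qed

lemma iso_arrow_cancel_left:
  assumes "iso_arrow C Y Z e" "f \<in> mor C X Y" "g \<in> mor C X Y" "e \<cdot> f = e \<cdot> g"
  shows "f = g"
proof -
  obtain e' where e: "e \<in> mor C Y Z" "e' \<in> mor C Z Y" "e' \<cdot> e = Idn C Y"
    using assms(1) by (auto simp: iso_arrow_def inverse_arrows_def)
  have "e' \<cdot> (e \<cdot> f) = e' \<cdot> (e \<cdot> g)"
    using assms(4) by simp
  then show ?thesis
    using e assms(2,3) by (simp add: comp_assoc comp_idn_left)
qed

text \<open>Subtraction has no symbol of its own in this setting: \<open>Idn A \<oplus> Neg s\<close> is \<open>1 - s\<close>.\<close>

lemma one_minus_mor: "s \<in> mor C A A \<Longrightarrow> Idn C A \<oplus>\<^sub>m Neg C A A s \<in> mor C A A"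
  using idn_closed mor_Obj Neg_mor Add_mor by metis

lemma one_minus_comp:
  assumes "s \<in> mor C A A" "h \<in> mor C P A"
  shows "(Idn C A \<oplus>\<^sub>m Neg C A A s) \<cdot> h = h \<oplus>\<^sub>m Neg C P A (s \<cdot> h)"
  using assms comp_add_left[OF assms(2) idn_closed Neg_mor[OF assms(1)]] mor_Obj[OF assms(1)]
  by (simp add: comp_idn_left Neg_comp)

lemma one_minus_comp_eq_self:
  assumes "s \<in> mor C A A" "h \<in> mor C P A" "s \<cdot> h = Zer C P A"
  shows "(Idn C A \<oplus>\<^sub>m Neg C A A s) \<cdot> h = h"
  using one_minus_comp[OF assms(1,2)] assms Neg_Zer Add_Zer mor_Obj by metis

end


section \<open>Long exact sequences in a triangulated category\<close>

context triangulated_category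
begin

lemma Sus_Obj: "X \<in> Obj S \<Longrightarrow> Sus S X \<in> Obj S"
  and SusA_Idn: "X \<in> Obj S \<Longrightarrow> SusA S (Idn S X) = Idn S (Sus S X)"
  and SusA_mor: "f \<in> mor S X Y \<Longrightarrow> SusA S f \<in> mor S (Sus S X) (Sus S Y)"
  and SusA_comp: "f \<in> mor S X Y \<Longrightarrow> g \<in> mor S Y Z \<Longrightarrow> SusA S (g \<cdot> f) = SusA S g \<cdot> SusA S f"
  using Sus_functor unfolding endofunctor_def by blast+

lemma DesA_mor: "f \<in> mor S X Y \<Longrightarrow> DesA S f \<in> mor S (Des S X) (Des S Y)"
  using Des_functor unfolding endofunctor_def by blast+

lemma SusA_group_hom:
  assumes "X \<in> Obj S" "Y \<in> Obj S"
  shows "group_hom (Hom S X Y) (Hom S (Sus S X) (Sus S Y)) (SusA S)"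
  using assms by (auto intro!: group_hom.intro group_hom_axioms.intro homI Hom_group Sus_Obj
      SusA_mor simp: Sus_additive)

lemma SusA_Zer: "X \<in> Obj S \<Longrightarrow> Y \<in> Obj S \<Longrightarrow> SusA S (Zer S X Y) = Zer S (Sus S X) (Sus S Y)"
  using group_hom.hom_one[OF SusA_group_hom] by fastforce

lemma SusA_Neg:
  "f \<in> mor S X Y \<Longrightarrow> SusA S (Neg S X Y f) = Neg S (Sus S X) (Sus S Y) (SusA S f)"
  using group_hom.hom_inv[OF SusA_group_hom, of X Y f] mor_Obj[of f X Y] by simp

lemma SusA_one_minus:
  assumes "s \<in> mor S A A"
  shows "SusA S (Idn S A \<oplus>\<^sub>m Neg S A A s)
    = Idn S (Sus S A) \<oplus>\<^sub>m Neg S (Sus S A) (Sus S A) (SusA S s)"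
  using assms mor_Obj[OF assms] by (simp add: Sus_additive[OF idn_closed Neg_mor] SusA_Idn SusA_Neg)

lemma zero_object_Sus:
  assumes "zero_object S Z"
  shows "zero_object S (Sus S Z)"
proof -
  have Z: "Z \<in> Obj S"
    using assms by (simp add: zero_object_def)
  then have "Idn S (Sus S Z) = Zer S (Sus S Z) (Sus S Z)"
    using assms SusA_Idn SusA_Zer zero_object_iff_Idn_eq_Zer by metis
  then show ?thesis
    using zero_object_iff_Idn_eq_Zer Sus_Obj Z by blast
qed

text \<open>Naturality of \<open>DesSus\<close> makes \<open>f\<close>, conjugated by isomorphisms, equal to \<open>DesA (SusA f)\<close>; so
  \<open>f\<close> can be recovered from \<open>SusA f\<close>.\<close>

lemma SusA_faithful:
  assumes "f \<in> mor S X Y" "g \<in> mor S X Y" "SusA S f = SusA S g"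
  shows "f = g"
proof (rule iso_arrow_cancel_right[OF DesSus_iso assms(1,2)])
  show "X \<in> Obj S"
    using mor_Obj assms(1) by blast
  show "f \<cdot> DesSus S X = g \<cdot> DesSus S X"
    using DesSus_natural[OF assms(1)] DesSus_natural[OF assms(2)] assms(3) by simp
qed

lemma DesA_faithful:
  assumes "f \<in> mor S X Y" "g \<in> mor S X Y" "DesA S f = DesA S g"
  shows "f = g"
proof (rule iso_arrow_cancel_right[OF SusDes_iso assms(1,2)])
  show "X \<in> Obj S"
    using mor_Obj assms(1) by blast
  show "f \<cdot> SusDes S X = g \<cdot> SusDes S X"
    using SusDes_natural[OF assms(1)] SusDes_natural[OF assms(2)] assms(3) by simp
qed

text \<open>The preimage of \<open>w\<close> is the conjugate of \<open>DesA w\<close> by the isomorphisms \<open>DesSus\<close>. Naturality shows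
  that \<open>w\<close> and the suspension of the conjugate agree after desuspension, and desuspension is
  faithful.\<close>

lemma SusA_full:
  assumes X: "X \<in> Obj S" and Y: "Y \<in> Obj S" and w: "w \<in> mor S (Sus S X) (Sus S Y)"
  obtains f where "f \<in> mor S X Y" "SusA S f = w"
proof -
  let ?eX = "DesSus S X" and ?eY = "DesSus S Y"
  obtain e where e: "?eX \<in> mor S (Des S (Sus S X)) X" "e \<in> mor S X (Des S (Sus S X))"
      "e \<cdot> ?eX = Idn S (Des S (Sus S X))"
    using DesSus_iso[OF X] by (auto simp: iso_arrow_def inverse_arrows_def)
  have eY: "?eY \<in> mor S (Des S (Sus S Y)) Y"
    using DesSus_iso[OF Y] by (auto simp: iso_arrow_def inverse_arrows_def)
  define v where "v = ?eY \<cdot> DesA S w"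
  have v: "v \<in> mor S (Des S (Sus S X)) Y"
    unfolding v_def using comp_closed[OF DesA_mor[OF w] eY] .
  define f where "f = v \<cdot> e"
  have f: "f \<in> mor S X Y"
    unfolding f_def using comp_closed[OF e(2) v] .
  have "?eY \<cdot> DesA S (SusA S f) = f \<cdot> ?eX"
    using DesSus_natural[OF f] by simp
  also have "\<dots> = ?eY \<cdot> DesA S w"
    unfolding f_def using comp_assoc[OF e(1,2) v] e(3) comp_idn_right[OF v] v_def by simp
  finally have "DesA S (SusA S f) = DesA S w"
    using iso_arrow_cancel_left[OF DesSus_iso[OF Y] DesA_mor[OF SusA_mor[OF f]] DesA_mor[OF w]] by simp
  then have "SusA S f = w"
    using DesA_faithful[OF SusA_mor[OF f] w] by simp
  with f show thesis
    using that by blast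
qed

lemma exact_triangle_mor:
  assumes "exact_triangle S X Y Z f g h"
  shows "f \<in> mor S X Y" "g \<in> mor S Y Z" "h \<in> mor S Z (Sus S X)"
  using assms by (auto simp: exact_triangle_def candidate_triangle_def)

lemma exact_triangle_rotate:
  assumes "exact_triangle S X Y Z f g h"
  shows "exact_triangle S Y Z (Sus S X) g h (Neg S (Sus S X) (Sus S Y) (SusA S f))"
  using assms triangle_rotate[of X Y Z f g h] by (simp add: exact_triangle_def)

text \<open>If the cone of \<open>f\<close> is zero, it can be replaced by the suspension of any zero object, and then
  the triangle rotates backwards. This puts \<open>f\<close> in the middle of an exact triangle without
  desuspending anything.\<close>

lemma exact_triangle_zero_start:
  assumes f: "exact_triangle S X Y T f g d" and T: "zero_object S T" and Z: "zero_object S Z"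
  shows "exact_triangle S Z X Y (Zer S Z X) f (Zer S Y (Sus S Z))"
proof -
  note m = exact_triangle_mor[OF f]
  have X: "X \<in> Obj S" and Y: "Y \<in> Obj S" and oT: "T \<in> Obj S" and oZ: "Z \<in> Obj S"
    using m mor_Obj Z by (auto simp: zero_object_def)
  have SZ: "zero_object S (Sus S Z)"
    using zero_object_Sus[OF Z] .
  note obj = X Y oT oZ Sus_Obj[OF X] Sus_Obj[OF oZ]
  have "exact_triangle S X Y (Sus S Z) f (Zer S Y (Sus S Z)) (Zer S (Sus S Z) (Sus S X))"
  proof (rule triangle_iso_closed[OF f _ iso_arrow_Idn[OF X] iso_arrow_Idn[OF Y]
        iso_arrow_zero_objects[OF T SZ]])
    show "candidate_triangle S X Y (Sus S Z) f (Zer S Y (Sus S Z)) (Zer S (Sus S Z) (Sus S X))"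
      using m obj by (simp add: candidate_triangle_def Zer_mor)
    show "Idn S Y \<cdot> f = f \<cdot> Idn S X"
      using m by (simp add: comp_idn_left comp_idn_right)
    show "Zer S T (Sus S Z) \<cdot> g = Zer S Y (Sus S Z) \<cdot> Idn S Y"
      using m obj by (simp add: Zer_comp comp_idn_right[OF Zer_mor])
    have "d = Zer S T (Sus S X)"
      using zero_object_mor_from[OF T m(3)] .
    then show "SusA S (Idn S X) \<cdot> d = Zer S (Sus S Z) (Sus S X) \<cdot> Zer S T (Sus S Z)"
      using m obj by (simp add: SusA_Idn comp_idn_left[OF Zer_mor] Zer_comp[OF Zer_mor])
  qed
  then show ?thesis
    using triangle_rotate[of Z X Y "Zer S Z X" f "Zer S Y (Sus S Z)"] m obj
    by (simp add: candidate_triangle_def Zer_mor SusA_Zer Neg_Zer)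
qed

lemma exact_triangle_zero_Idn:
  assumes "X \<in> Obj S" "zero_object S Z"
  shows "exact_triangle S Z X X (Zer S Z X) (Idn S X) (Zer S X (Sus S Z))"
  using exact_triangle_zero_start[OF triangle_idn[OF assms] assms(2,2)] .

text \<open>The morphism from the triangle on the identity of \<open>X\<close> that extends \<open>f\<close> shows that \<open>g \<cdot> f\<close>
  factors through a zero object.\<close>

lemma exact_triangle_comp_zero:
  assumes f: "exact_triangle S X Y Z f g h"
  shows "g \<cdot> f = Zer S X Z"
proof -
  note m = exact_triangle_mor[OF f]
  have X: "X \<in> Obj S" and Z: "Z \<in> Obj S"
    using m mor_Obj by auto
  obtain O' where O': "zero_object S O'"
    using zero_object_exists by blast
  then have oO': "O' \<in> Obj S"
    by (simp add: zero_object_def)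
  obtain c where c: "c \<in> mor S O' Z" "c \<cdot> Zer S X O' = g \<cdot> f"
    using triangle_morphism[OF triangle_idn[OF X O'] f idn_closed[OF X] m(1)] by auto
  then show ?thesis
    using comp_Zer[OF c(1) X] by simp
qed

text \<open>Exactness of \<open>Hom(-, W)\<close>: the factor is the third component of a morphism to the triangle on the
  identity of \<open>W\<close>.\<close>

lemma exact_triangle_factor_right:
  assumes f: "exact_triangle S X Y Z f g h" and y: "y \<in> mor S Y W" and yf: "y \<cdot> f = Zer S X W"
  obtains c where "c \<in> mor S Z W" "c \<cdot> g = y"
proof -
  note m = exact_triangle_mor[OF f]
  have X: "X \<in> Obj S" and W: "W \<in> Obj S"
    using m y mor_Obj by auto
  obtain O' where O': "zero_object S O'"
    using zero_object_exists by blast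
  then have oO': "O' \<in> Obj S"
    by (simp add: zero_object_def)
  have "y \<cdot> f = Zer S O' W \<cdot> Zer S X O'"
    using yf Zer_comp[OF Zer_mor] X W oO' by simp
  then obtain c where "c \<in> mor S Z W" "c \<cdot> g = Idn S W \<cdot> y"
    using triangle_morphism[OF f exact_triangle_zero_Idn[OF W O'] Zer_mor[OF X oO'] y] by blast
  then show thesis
    using that comp_idn_left[OF y] by simp
qed

text \<open>Exactness of \<open>Hom(P, -)\<close>. The axiom on morphisms of triangles supplies a third component only,
  so both the triangle on the identity of \<open>P\<close> and the given one are rotated first. The component
  that results is a map of suspensions, and full faithfulness brings it back to a map \<open>P \<rightarrow> X\<close>.\<close>

lemma exact_triangle_factor_left:
  assumes f: "exact_triangle S X Y Z f g h" and u: "u \<in> mor S P Y" and gu: "g \<cdot> u = Zer S P Z"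
  obtains v where "v \<in> mor S P X" "f \<cdot> v = u"
proof -
  note m = exact_triangle_mor[OF f]
  have P: "P \<in> Obj S" and X: "X \<in> Obj S" and Y: "Y \<in> Obj S" and Z: "Z \<in> Obj S"
    using m u mor_Obj by auto
  obtain O' where O': "zero_object S O'"
    using zero_object_exists by blast
  then have oO': "O' \<in> Obj S"
    by (simp add: zero_object_def)
  let ?SP = "Sus S P"
  have tP: "exact_triangle S P O' ?SP (Zer S P O') (Zer S O' ?SP) (Neg S ?SP ?SP (Idn S ?SP))"
    using exact_triangle_rotate[OF triangle_idn[OF P O']] SusA_Idn[OF P] by simp
  have "Zer S O' Z \<cdot> Zer S P O' = g \<cdot> u"
    using gu Zer_comp[OF Zer_mor] P Z oO' by simp
  then obtain c where c: "c \<in> mor S ?SP (Sus S X)"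
      "SusA S u \<cdot> Neg S ?SP ?SP (Idn S ?SP) = Neg S (Sus S X) (Sus S Y) (SusA S f) \<cdot> c"
    using triangle_morphism[OF tP exact_triangle_rotate[OF f] u Zer_mor[OF oO' Z]] by blast
  obtain v where v: "v \<in> mor S P X" "SusA S v = c"
    using SusA_full[OF P X c(1)] .
  have fv: "f \<cdot> v \<in> mor S P Y"
    using comp_closed[OF v(1) m(1)] .
  have "Neg S ?SP (Sus S Y) (SusA S u) = Neg S ?SP (Sus S Y) (SusA S (f \<cdot> v))"
    using c(2) comp_Neg[OF idn_closed[OF Sus_Obj[OF P]] SusA_mor[OF u]]
      Neg_comp[OF c(1) SusA_mor[OF m(1)]] SusA_comp[OF v(1) m(1)] v(2)
      comp_idn_right[OF SusA_mor[OF u]] by simp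
  then have "u = f \<cdot> v"
    using Neg_inject[OF SusA_mor[OF u] SusA_mor[OF fv]] SusA_faithful[OF u fv] by blast
  then show thesis
    using that v(1) by simp
qed

text \<open>The two neighbouring terms in the long exact sequence of \<open>Hom(-, W)\<close> vanish: injectivity comes
  from the given triangle, surjectivity from the one that starts with the zero object.\<close>

lemma zero_cone_bij_precomp:
  assumes f: "exact_triangle S X Y T f g d" and T: "zero_object S T" and W: "W \<in> Obj S"
  shows "bij_betw (\<lambda>m. m \<cdot> f) (mor S Y W) (mor S X W)"
proof -
  note m = exact_triangle_mor[OF f]
  have X: "X \<in> Obj S" and Y: "Y \<in> Obj S"
    using m mor_Obj by auto
  interpret h: group_hom "Hom S Y W" "Hom S X W" "\<lambda>m. m \<cdot> f"
    using precomp_group_hom[OF m(1) W] .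
  have "x = Zer S Y W" if x: "x \<in> mor S Y W" "x \<cdot> f = Zer S X W" for x
  proof -
    obtain c where c: "c \<in> mor S T W" "c \<cdot> g = x"
      using exact_triangle_factor_right[OF f x] .
    then show ?thesis
      using zero_object_mor_from[OF T c(1)] Zer_comp[OF m(2) W] by simp
  qed
  then have "inj_on (\<lambda>m. m \<cdot> f) (mor S Y W)"
    using h.inj_on_one_iff by simp
  moreover have "y \<in> (\<lambda>m. m \<cdot> f) ` mor S Y W" if y: "y \<in> mor S X W" for y
  proof -
    have oT: "T \<in> Obj S"
      using T by (simp add: zero_object_def)
    show ?thesis
      using exact_triangle_factor_right[OF exact_triangle_zero_start[OF f T T] y comp_Zer[OF y oT]]
      by (metis imageI)
  qed
  ultimately show ?thesis
    using comp_closed[OF m(1)] by (auto simp: bij_betw_def)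
qed

end


section \<open>Iterated suspensions\<close>

context triangulated_category
begin

lemma funpow_mor:
  assumes "\<And>X Y f. f \<in> mor S X Y \<Longrightarrow> G f \<in> mor S (F X) (F Y)" "f \<in> mor S X Y"
  shows "(G ^^ n) f \<in> mor S ((F ^^ n) X) ((F ^^ n) Y)"
  by (induction n) (use assms in auto)

lemma sus_powA_mor: "f \<in> mor S X Y \<Longrightarrow> sus_powA S n f \<in> mor S (sus_pow S n X) (sus_pow S n Y)"
  using funpow_mor[OF SusA_mor] funpow_mor[OF DesA_mor] by (simp add: sus_pow_def sus_powA_def)

lemma sus_powA_stable:
  assumes "stable_class S \<P> \<I>" "f \<in> \<I>"
  shows "sus_powA S n f \<in> \<I>"
proof -
  have "(SusA S ^^ k) f \<in> \<I>" "(DesA S ^^ k) f \<in> \<I>" for k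
    by (induction k) (use assms in \<open>auto simp: stable_class_def\<close>)
  then show ?thesis
    by (simp add: sus_powA_def)
qed

end


section \<open>Limits of towers\<close>

text \<open>The unit lies in the kernel because each \<open>q k\<close> preserves it, and injectivity leaves nothing else.
  By surjectivity, \<open>lim1\<close> is the quotient of the product by itself.\<close>

lemma trivial_lim0_lim1_of_bij:
  fixes G :: "nat \<Rightarrow> 'a monoid"
  assumes G: "\<And>k. group (G k)" and q: "\<And>k. q k \<in> hom (G (Suc k)) (G k)"
    and bij: "bij_betw (one_minus_shift G q)
      (carrier (product_group UNIV G)) (carrier (product_group UNIV G))"
  shows "trivial_group (lim0 G q)" "trivial_group (lim1 G q)"
proof -
  let ?P = "product_group UNIV G"
  interpret P: group ?P
    using G by simp
  have "one_minus_shift G q \<one>\<^bsub>?P\<^esub> = \<one>\<^bsub>?P\<^esub>"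
  proof
    fix k
    have "q k \<one>\<^bsub>G (Suc k)\<^esub> = \<one>\<^bsub>G k\<^esub>"
      using hom_one[OF q G G] .
    then show "one_minus_shift G q \<one>\<^bsub>?P\<^esub> k = \<one>\<^bsub>?P\<^esub> k"
      using group.r_inv[OF G monoid.one_closed[OF group.is_monoid[OF G]]] by (simp add: one_minus_shift_def)
  qed
  then have "x = \<one>\<^bsub>?P\<^esub>" if "x \<in> carrier ?P" "one_minus_shift G q x = \<one>\<^bsub>?P\<^esub>" for x
    using inj_onD[OF bij_betw_imp_inj_on[OF bij]] that P.one_closed by metis
  then have "kernel ?P ?P (one_minus_shift G q) = {\<one>\<^bsub>?P\<^esub>}"
    using \<open>one_minus_shift G q \<one>\<^bsub>?P\<^esub> = \<one>\<^bsub>?P\<^esub>\<close> P.one_closed unfolding kernel_def by blast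
  then have "lim0 G q = ?P\<lparr>carrier := {\<one>\<^bsub>?P\<^esub>}\<rparr>"
    by (simp add: lim0_def)
  then show "trivial_group (lim0 G q)"
    using subgroup.subgroup_is_group[OF P.triv_subgroup P.is_group]
    by (simp add: trivial_group_def)
  have "lim1 G q = ?P Mod carrier ?P"
    unfolding lim1_def using bij_betw_imp_surj_on[OF bij] by simp
  moreover have normal: "carrier ?P \<lhd> ?P"
    unfolding P.normal_inv_iff using P.subgroup_self by blast
  moreover have "carrier (?P Mod carrier ?P) = {\<one>\<^bsub>?P Mod carrier ?P\<^esub>}"
    unfolding carrier_FactGroup one_FactGroup
    using subgroup.rcos_const[OF P.subgroup_self P.is_group] P.one_closed by blast
  ultimately show "trivial_group (lim1 G q)"
    using normal.factorgroup_is_group[OF normal] unfolding trivial_group_def by simp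
qed

lemma coproduct_factor:
  assumes "coproduct C J X A \<iota>" "B \<in> Obj C" "\<And>j. j \<in> J \<Longrightarrow> f j \<in> mor C (X j) B"
  obtains g where "g \<in> mor C A B" "\<And>j. j \<in> J \<Longrightarrow> g \<cdot>\<^bsub>C\<^esub> \<iota> j = f j"
  using assms unfolding coproduct_def by blast

lemma (in category) coproduct_bij:
  assumes A: "coproduct C J X A \<iota>" and Y: "Y \<in> Obj C"
  shows "bij_betw (\<lambda>m. \<lambda>j\<in>J. m \<cdot>\<^bsub>C\<^esub> \<iota> j) (mor C A Y) (\<Pi>\<^sub>E j\<in>J. mor C (X j) Y)"
proof -
  have \<iota>: "\<And>j. j \<in> J \<Longrightarrow> \<iota> j \<in> mor C (X j) A"
    and ex1: "\<And>f. (\<And>j. j \<in> J \<Longrightarrow> f j \<in> mor C (X j) Y)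
      \<Longrightarrow> \<exists>!g. g \<in> mor C A Y \<and> (\<forall>j\<in>J. g \<cdot>\<^bsub>C\<^esub> \<iota> j = f j)"
    using A Y by (auto simp: coproduct_def)
  show ?thesis
  proof (rule bij_betw_imageI)
    show "inj_on (\<lambda>m. \<lambda>j\<in>J. m \<cdot>\<^bsub>C\<^esub> \<iota> j) (mor C A Y)"
    proof (rule inj_onI)
      fix m m' assume m: "m \<in> mor C A Y" "m' \<in> mor C A Y"
        and eq: "(\<lambda>j\<in>J. m \<cdot>\<^bsub>C\<^esub> \<iota> j) = (\<lambda>j\<in>J. m' \<cdot>\<^bsub>C\<^esub> \<iota> j)"
      have "\<forall>j\<in>J. m \<cdot>\<^bsub>C\<^esub> \<iota> j = m' \<cdot>\<^bsub>C\<^esub> \<iota> j"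
        using eq by (metis restrict_apply')
      then show "m = m'"
        using ex1[of "\<lambda>j. m' \<cdot>\<^bsub>C\<^esub> \<iota> j"] m comp_closed[OF \<iota>] by blast
    qed
    show "(\<lambda>m. \<lambda>j\<in>J. m \<cdot>\<^bsub>C\<^esub> \<iota> j) ` mor C A Y = (\<Pi>\<^sub>E j\<in>J. mor C (X j) Y)"
    proof (intro equalityI subsetI)
      fix x assume x: "x \<in> (\<Pi>\<^sub>E j\<in>J. mor C (X j) Y)"
      then obtain m where m: "m \<in> mor C A Y" "\<forall>j\<in>J. m \<cdot>\<^bsub>C\<^esub> \<iota> j = x j"
        using ex1[of x] by (auto simp: PiE_iff)
      then have "(\<lambda>j\<in>J. m \<cdot>\<^bsub>C\<^esub> \<iota> j) = x"
        using x by (auto simp: PiE_iff extensional_def)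
      then show "x \<in> (\<lambda>m. \<lambda>j\<in>J. m \<cdot>\<^bsub>C\<^esub> \<iota> j) ` mor C A Y"
        using m by blast
    qed (use comp_closed[OF \<iota>] in auto)
  qed
qed


section \<open>Null maps and projective classes\<close>

context triangulated_category
begin

lemma null_maps_iff:
  assumes "f \<in> mor S X Y"
  shows "f \<in> null_maps S \<P> \<longleftrightarrow> (\<forall>P\<in>\<P>. \<forall>h\<in>mor S P X. f \<cdot> h = Zer S P Y)"
  using assms by (auto simp: null_maps_def mor_def)

lemma null_maps_comp_left:
  assumes "f \<in> mor S X Y" "f \<in> null_maps S \<P>" "t \<in> mor S Y Z"
  shows "t \<cdot> f \<in> null_maps S \<P>"
proof -
  have "(t \<cdot> f) \<cdot> h = Zer S P Z" if "P \<in> \<P>" "h \<in> mor S P X" for P h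
  proof -
    have "f \<cdot> h = Zer S P Y"
      using assms that null_maps_iff by blast
    then show ?thesis
      using comp_assoc[OF that(2) assms(1,3)] comp_Zer[OF assms(3)] mor_Obj(1)[OF that(2)] by simp
  qed
  then show ?thesis
    using null_maps_iff[OF comp_closed[OF assms(1,3)]] by blast
qed

lemma proj_objects_zero:
  assumes "zero_object S Z" "\<I> \<subseteq> Arr S"
  shows "Z \<in> proj_objects S \<I>"
proof -
  have "f \<cdot> h = Zer S Z (Cod S f)" if "f \<in> \<I>" "h \<in> mor S Z (Dom S f)" for f h
  proof -
    have "f \<in> mor S (Dom S f) (Cod S f)"
      using that assms by (auto simp: mor_def)
    then show ?thesis
      using zero_object_mor_from[OF assms(1) comp_closed[OF that(2)]] by blast
  qed
  then show ?thesis
    using assms(1) by (auto simp: proj_objects_def zero_object_def)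
qed

text \<open>Both \<open>1 - s\<close> and its suspension act as the identity on maps out of an object of \<open>\<P>\<close>. In the
  exact sequence \<open>Hom(P, A) \<rightarrow> Hom(P, A) \<rightarrow> Hom(P, T) \<rightarrow> Hom(P, Sus A) \<rightarrow> Hom(P, Sus A)\<close> the outer
  maps are therefore bijective (the last up to sign), so the middle group is zero.\<close>

lemma cone_one_minus_null_zero:
  assumes gen: "generates S \<P>" and sub: "\<P> \<subseteq> Obj S"
    and s: "s \<in> mor S A A" "s \<in> null_maps S \<P>" "SusA S s \<in> null_maps S \<P>"
    and tri: "exact_triangle S A A T (Idn S A \<oplus>\<^sub>m Neg S A A s) g d"
  shows "zero_object S T"
proof -
  let ?\<phi> = "Idn S A \<oplus>\<^sub>m Neg S A A s"
  note m = exact_triangle_mor[OF tri]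
  note rot = exact_triangle_rotate[OF tri]
  have A: "A \<in> Obj S" and T: "T \<in> Obj S"
    using m mor_Obj by auto
  have "u = Zer S P T" if P: "P \<in> \<P>" and u: "u \<in> mor S P T" for P u
  proof -
    have du: "d \<cdot> u \<in> mor S P (Sus S A)"
      using comp_closed[OF u m(3)] .
    have \<phi>d: "SusA S ?\<phi> \<cdot> d \<in> mor S T (Sus S A)"
      using comp_closed[OF m(3) SusA_mor[OF m(1)]] .
    have "Neg S T (Sus S A) (SusA S ?\<phi> \<cdot> d) = Zer S T (Sus S A)"
      using exact_triangle_comp_zero[OF exact_triangle_rotate[OF rot]] Neg_comp[OF m(3) SusA_mor[OF m(1)]] by simp
    then have "SusA S ?\<phi> \<cdot> d = Zer S T (Sus S A)"
      using Neg_Neg[OF \<phi>d] Neg_Zer[OF T Sus_Obj[OF A]] by simp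
    \<comment> \<open>First \<open>d \<cdot> u\<close> is zero, because it equals its composite with the suspension of \<open>1 - s\<close>.\<close>
    then have "SusA S ?\<phi> \<cdot> (d \<cdot> u) = Zer S P (Sus S A)"
      using comp_assoc[OF u m(3) SusA_mor[OF m(1)]] Zer_comp[OF u Sus_Obj[OF A]] by simp
    moreover have "SusA S ?\<phi> \<cdot> (d \<cdot> u) = d \<cdot> u"
      using one_minus_comp_eq_self[OF SusA_mor[OF s(1)] du] null_maps_iff[OF SusA_mor[OF s(1)]]
        s(3) P du SusA_one_minus[OF s(1)] by simp
    ultimately have "d \<cdot> u = Zer S P (Sus S A)"
      by simp
    then obtain v where v: "v \<in> mor S P A" "g \<cdot> v = u"
      using exact_triangle_factor_left[OF rot u] by blast
    \<comment> \<open>So \<open>u\<close> factors as \<open>g \<cdot> v\<close>, and \<open>v\<close> may be replaced by its composite with \<open>1 - s\<close>.\<close>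
    have "?\<phi> \<cdot> v = v"
      using one_minus_comp_eq_self[OF s(1) v(1)] null_maps_iff[OF s(1)] s(2) P v(1) by blast
    then have "u = (g \<cdot> ?\<phi>) \<cdot> v"
      using v comp_assoc[OF v(1) m(1,2)] by simp
    then show ?thesis
      using exact_triangle_comp_zero[OF tri] Zer_comp[OF v(1) T] by simp
  qed
  then have "trivial_group (Hom S P T)" if "P \<in> \<P>" for P
    using that sub T Zer_mor[of P T] Hom_group[of P T] by (auto simp: trivial_group_def)
  then show ?thesis
    using gen T unfolding generates_def by blast
qed

text \<open>The two coproducts are those of the sources and of the targets of the \<open>f k\<close>. The second one is
  not identified with a summand of the first; the comparison map \<open>t\<close> is all that the shift needs.\<close>

lemma bij_one_minus_shift_null_tower:
  assumes gen: "generates S \<P>" and sub: "\<P> \<subseteq> Obj S"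
    and closed: "closed_under_countable_coproducts S (null_maps S \<P>)"
    and Sus: "\<And>f. f \<in> null_maps S \<P> \<Longrightarrow> SusA S f \<in> null_maps S \<P>"
    and f: "\<And>k. f k \<in> mor S (X k) (X (Suc k))" "\<And>k. f k \<in> null_maps S \<P>"
    and Y: "Y \<in> Obj S"
    and cop: "has_coproduct S (UNIV :: nat set) X" "has_coproduct S (UNIV :: nat set) (\<lambda>k. X (Suc k))"
  shows "bij_betw (one_minus_shift (\<lambda>k. Hom S (X k) Y) (\<lambda>k x. x \<cdot> f k))
    (carrier (product_group UNIV (\<lambda>k. Hom S (X k) Y)))
    (carrier (product_group UNIV (\<lambda>k. Hom S (X k) Y)))"
proof -
  obtain A \<iota> where A: "coproduct S (UNIV :: nat set) X A \<iota>"
    using cop(1) unfolding has_coproduct_def by blast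
  obtain B \<kappa> where B: "coproduct S (UNIV :: nat set) (\<lambda>k. X (Suc k)) B \<kappa>"
    using cop(2) unfolding has_coproduct_def by blast
  have oA: "A \<in> Obj S" and \<iota>: "\<And>k. \<iota> k \<in> mor S (X k) A"
    and oB: "B \<in> Obj S" and \<kappa>: "\<And>k. \<kappa> k \<in> mor S (X (Suc k)) B"
    using A B by (auto simp: coproduct_def)
  obtain F where F: "F \<in> mor S A B" "\<And>k. F \<cdot> \<iota> k = \<kappa> k \<cdot> f k"
    using coproduct_factor[OF A oB, of "\<lambda>k. \<kappa> k \<cdot> f k"] comp_closed[OF f(1) \<kappa>] by auto
  obtain t where t: "t \<in> mor S B A" "\<And>k. t \<cdot> \<kappa> k = \<iota> (Suc k)"
    using coproduct_factor[OF B oA, of "\<lambda>k. \<iota> (Suc k)"] \<iota> by auto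
  have F_null: "F \<in> null_maps S \<P>"
    by (rule closed[unfolded closed_under_countable_coproducts_def, rule_format, OF _ A B F(1)])
      (use f F(2) in auto)
  define s where "s = t \<cdot> F"
  have s: "s \<in> mor S A A"
    unfolding s_def using comp_closed[OF F(1) t(1)] .
  have s_null: "s \<in> null_maps S \<P>"
    unfolding s_def using null_maps_comp_left[OF F(1) F_null t(1)] .
  have s_\<iota>: "s \<cdot> \<iota> k = \<iota> (Suc k) \<cdot> f k" for k
    unfolding s_def using comp_assoc[OF \<iota> F(1) t(1), of k] F(2)[of k]
      comp_assoc[OF f(1) \<kappa> t(1), of k] t(2)[of k] by simp
  let ?\<phi> = "Idn S A \<oplus>\<^sub>m Neg S A A s"
  have \<phi>: "?\<phi> \<in> mor S A A"
    using one_minus_mor[OF s] .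
  obtain T g d where tri: "exact_triangle S A A T ?\<phi> g d"
    using triangle_complete[OF \<phi>] by blast
  have "zero_object S T"
    using cone_one_minus_null_zero[OF gen sub s s_null Sus[OF s_null] tri] .
  then have bij_\<phi>: "bij_betw (\<lambda>m. m \<cdot> ?\<phi>) (mor S A Y) (mor S A Y)"
    using zero_cone_bij_precomp[OF tri _ Y] by blast
  let ?c = "\<lambda>m. \<lambda>k\<in>UNIV. m \<cdot> \<iota> k"
  let ?D = "one_minus_shift (\<lambda>k. Hom S (X k) Y) (\<lambda>k x. x \<cdot> f k)"
  have bij_c: "bij_betw ?c (mor S A Y) (\<Pi>\<^sub>E k\<in>UNIV. mor S (X k) Y)"
    using coproduct_bij[OF A Y] .
  \<comment> \<open>Under \<open>?c\<close>, which restricts a map on \<open>A\<close> to the summands, \<open>?D\<close> is precomposition with \<open>1 - s\<close>.\<close>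
  have square: "?D (?c m) = ?c (m \<cdot> ?\<phi>)" if m: "m \<in> mor S A Y" for m
  proof
    fix k
    have "(m \<cdot> ?\<phi>) \<cdot> \<iota> k = m \<cdot> (\<iota> k \<oplus>\<^sub>m Neg S (X k) A (s \<cdot> \<iota> k))"
      using comp_assoc[OF \<iota> \<phi> m] one_minus_comp[OF s \<iota>] by simp
    also have "\<dots> = m \<cdot> \<iota> k \<oplus>\<^sub>m m \<cdot> Neg S (X k) A (s \<cdot> \<iota> k)"
      using comp_add_right[OF \<iota> Neg_mor[OF comp_closed[OF \<iota> s]] m] .
    also have "\<dots> = m \<cdot> \<iota> k \<oplus>\<^sub>m Neg S (X k) Y (m \<cdot> (\<iota> (Suc k) \<cdot> f k))"
      using comp_Neg[OF comp_closed[OF \<iota> s] m] s_\<iota> by simp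
    also have "\<dots> = ?D (?c m) k"
      using comp_assoc[OF f(1) \<iota> m] by (simp add: one_minus_shift_def)
    finally show "?D (?c m) k = ?c (m \<cdot> ?\<phi>) k"
      by simp
  qed
  have "bij_betw (\<lambda>m. ?c (m \<cdot> ?\<phi>)) (mor S A Y) (\<Pi>\<^sub>E k\<in>UNIV. mor S (X k) Y)"
    using bij_betw_trans[OF bij_\<phi> bij_c] by (simp add: comp_def)
  then have "bij_betw (?D \<circ> ?c) (mor S A Y) (\<Pi>\<^sub>E k\<in>UNIV. mor S (X k) Y)"
    using square bij_betw_cong[of "mor S A Y" "?D \<circ> ?c" "\<lambda>m. ?c (m \<cdot> ?\<phi>)"] by simp
  then have "bij_betw ?D (\<Pi>\<^sub>E k\<in>UNIV. mor S (X k) Y) (\<Pi>\<^sub>E k\<in>UNIV. mor S (X k) Y)"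
    using bij_betw_comp_iff[OF bij_c] by blast
  then show ?thesis
    by simp
qed

text \<open>An infinite index type contains a copy of the natural numbers, along which a sequence can be
  reindexed.\<close>

lemma has_countable_coproduct:
  fixes X :: "nat \<Rightarrow> 'o"
  assumes "infinite (UNIV :: 'i set)" "has_set_coproducts TYPE('i) S" "\<And>k. X k \<in> Obj S"
  shows "has_coproduct S UNIV X"
proof -
  obtain e :: "nat \<Rightarrow> 'i" where e: "inj e"
    using infinite_countable_subset[OF assms(1)] by blast
  let ?X = "\<lambda>j. X (inv_into UNIV e j)"
  obtain A \<iota> where A: "coproduct S (range e) ?X A \<iota>"
    using assms(2,3) unfolding has_set_coproducts_def has_coproduct_def by meson
  have inv_e: "inv_into UNIV e (e k) = k" for k
    using e by simp
  have "coproduct S UNIV X A (\<lambda>k. \<iota> (e k))"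
    unfolding coproduct_def
  proof (intro conjI ballI allI impI)
    show "A \<in> Obj S"
      using A by (simp add: coproduct_def)
  next
    fix k
    have "\<iota> (e k) \<in> mor S (?X (e k)) A"
      using A unfolding coproduct_def by blast
    then show "\<iota> (e k) \<in> mor S (X k) A"
      by (simp add: inv_e)
  next
    fix B f assume "B \<in> Obj S" "\<forall>j\<in>UNIV. f j \<in> mor S (X j) B"
    then have "\<exists>!g. g \<in> mor S A B \<and> (\<forall>j\<in>range e. g \<cdot> \<iota> j = f (inv_into UNIV e j))"
      using A[unfolded coproduct_def, THEN conjunct2, THEN conjunct2, rule_format,
          of B "\<lambda>j. f (inv_into UNIV e j)"] by blast
    then show "\<exists>!g. g \<in> mor S A B \<and> (\<forall>k\<in>UNIV. g \<cdot> \<iota> (e k) = f k)"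
      by (simp add: inv_e)
  qed
  then show ?thesis
    unfolding has_coproduct_def by blast
qed

end


section \<open>Convergence and generation\<close>

context triangulated_category
begin

text \<open>The constant resolution \<open>X = X = \<dots>\<close> detects \<open>X\<close>: the constant sequence at the identity of \<open>X\<close>
  lies in the limit of its tower in degree 0.\<close>

lemma zero_of_conditionally_convergent:
  assumes pc: "projective_class S \<P> \<I>" and X: "X \<in> Obj S"
    and conv: "adams_ss_conditionally_convergent S \<P> \<I> X X"
    and triv: "\<And>P. P \<in> \<P> \<Longrightarrow> trivial_group (Hom S P X)"
  shows "zero_object S X"
proof -
  have \<I>: "\<I> = null_maps S \<P>" and \<P>: "\<P> = proj_objects S \<I>"
    using pc by (auto simp: projective_class_def)
  obtain Z where Z: "zero_object S Z"
    using zero_object_exists by blast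
  have "\<I> \<subseteq> Arr S"
    unfolding \<I> null_maps_def by blast
  then have "Z \<in> \<P>"
    using proj_objects_zero[OF Z] \<P> by blast
  moreover have "Idn S X \<in> \<I>"
    unfolding \<I> null_maps_iff[OF idn_closed[OF X]]
    using triv Zer_mor comp_idn_left mor_Obj unfolding trivial_group_def Hom_simps by (metis singletonD)
  ultimately have "adams_resolution S \<P> \<I> X \<lparr>rX = \<lambda>_. X, rP = \<lambda>_. Z, rp = \<lambda>_. Zer S Z X,
      ri = \<lambda>_. Idn S X, rd = \<lambda>_. Zer S X (Sus S Z)\<rparr>" (is "adams_resolution _ _ _ _ ?R")
    using exact_triangle_zero_Idn[OF X Z] by (simp add: adams_resolution_def)
  then have "conditionally_convergent (adams_couple S ?R X)"
    using conv unfolding adams_ss_conditionally_convergent_def by blast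
  then have "trivial_group (lim0 (\<lambda>s. cD (adams_couple S ?R X) s 0) (\<lambda>s. ci (adams_couple S ?R X) s 0))"
    unfolding conditionally_convergent_def by blast
  then have "trivial_group (lim0 (\<lambda>_. Hom S X X) (\<lambda>_ f. f \<cdot> Idn S X))"
    by (simp add: adams_couple_def graded_Hom_def sus_pow_def sus_powA_def)
  moreover have "one_minus_shift (\<lambda>_. Hom S X X) (\<lambda>_ f. f \<cdot> Idn S X) (\<lambda>_. Idn S X) = (\<lambda>_. Zer S X X)"
    using comp_idn_left[OF idn_closed[OF X]] Add_Neg[OF idn_closed[OF X]]
    by (simp add: one_minus_shift_def)
  then have "(\<lambda>_. Idn S X) \<in> carrier (lim0 (\<lambda>_. Hom S X X) (\<lambda>_ f. f \<cdot> Idn S X))"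
    using idn_closed[OF X] by (simp add: lim0_def kernel_def restrict_def PiE_iff)
  ultimately have "(\<lambda>_::nat. Idn S X) = (\<lambda>_. Zer S X X)"
    by (simp add: trivial_group_def lim0_def restrict_def)
  then have "Idn S X = Zer S X X"
    by meson
  then show ?thesis
    using zero_object_iff_Idn_eq_Zer[OF X] by blast
qed

text \<open>In internal degree \<open>n\<close>, the tower in question is that of \<open>Hom(-, Y)\<close> on the \<open>n\<close>-fold suspension
  of the resolution, whose maps are null because the class is stable.\<close>

lemma conditionally_convergent_of_generates:
  assumes "infinite (UNIV :: 'i set)" "has_set_coproducts TYPE('i) S"
    and pc: "projective_class S \<P> \<I>" and stable: "stable_class S \<P> \<I>"
    and closed: "closed_under_countable_coproducts S \<I>"
    and gen: "generates S \<P>" and Y: "Y \<in> Obj S"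
  shows "adams_ss_conditionally_convergent S \<P> \<I> X Y"
  unfolding adams_ss_conditionally_convergent_def
proof (intro allI impI)
  fix R assume R: "adams_resolution S \<P> \<I> X R"
  have \<I>: "\<I> = null_maps S \<P>" and "\<P> = proj_objects S \<I>"
    using pc by (auto simp: projective_class_def)
  then have sub: "\<P> \<subseteq> Obj S"
    by (auto simp: proj_objects_def)
  have Sus: "SusA S f \<in> null_maps S \<P>" if "f \<in> null_maps S \<P>" for f
    using stable that \<I> by (simp add: stable_class_def)
  have i: "ri R k \<in> mor S (rX R k) (rX R (Suc k))" "ri R k \<in> \<I>" for k
    using R exact_triangle_mor(2) unfolding adams_resolution_def by blast+
  show "conditionally_convergent (adams_couple S R Y)"
    unfolding conditionally_convergent_def
  proof
    fix n
    let ?X = "\<lambda>k. sus_pow S n (rX R k)" and ?f = "\<lambda>k. sus_powA S n (ri R k)"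
    have f: "?f k \<in> mor S (?X k) (?X (Suc k))" for k
      using sus_powA_mor[OF i(1)] .
    have f_null: "?f k \<in> null_maps S \<P>" for k
      using sus_powA_stable[OF stable i(2)] \<I> by simp
    have X: "?X k \<in> Obj S" for k
      using mor_Obj(1)[OF f] .
    note cop = has_countable_coproduct[OF assms(1,2)]
    have bij: "bij_betw (one_minus_shift (\<lambda>k. Hom S (?X k) Y) (\<lambda>k x. x \<cdot> ?f k))
        (carrier (product_group UNIV (\<lambda>k. Hom S (?X k) Y)))
        (carrier (product_group UNIV (\<lambda>k. Hom S (?X k) Y)))"
      by (rule bij_one_minus_shift_null_tower[OF gen sub closed[unfolded \<I>] Sus f f_null Y
            cop[of ?X, OF X] cop[of "\<lambda>k. ?X (Suc k)", OF X]])
    have hom: "(\<lambda>x. x \<cdot> ?f k) \<in> hom (Hom S (?X (Suc k)) Y) (Hom S (?X k) Y)" for k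
      using group_hom.homh[OF precomp_group_hom[OF f Y]] .
    show "trivial_group (lim0 (\<lambda>s. cD (adams_couple S R Y) s n) (\<lambda>s. ci (adams_couple S R Y) s n)) \<and>
        trivial_group (lim1 (\<lambda>s. cD (adams_couple S R Y) s n) (\<lambda>s. ci (adams_couple S R Y) s n))"
      using trivial_lim0_lim1_of_bij[OF Hom_group[OF X Y] hom bij]
      by (simp add: adams_couple_def graded_Hom_def)
  qed
qed

end


theorem proposition4p4:
  fixes S :: "('o, 'm) tri_cat" and \<P> :: "'o set" and \<I> :: "'m set"
  assumes "triangulated_category S"
    and "infinite (UNIV :: 'i set)"
    and "has_set_coproducts TYPE('i) S"
    and "projective_class S \<P> \<I>"
    and "stable_class S \<P> \<I>"
    and "closed_under_countable_coproducts S \<I>"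
  shows "(\<forall>X\<in>Obj S. \<forall>Y\<in>Obj S. adams_ss_conditionally_convergent S \<P> \<I> X Y)
         \<longleftrightarrow> generates S \<P>"
proof -
  interpret triangulated_category S
    by fact
  have "generates S \<P>" if "\<forall>X\<in>Obj S. \<forall>Y\<in>Obj S. adams_ss_conditionally_convergent S \<P> \<I> X Y"
    unfolding generates_def using that zero_of_conditionally_convergent[OF assms(4)] by blast
  moreover have "adams_ss_conditionally_convergent S \<P> \<I> X Y"
    if "generates S \<P>" "Y \<in> Obj S" for X Y
    using conditionally_convergent_of_generates[OF assms(2-6) that] .
  ultimately show ?thesis
    by blast
qed

end
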